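(* For any uncountable analytic family $\mathcal{A}$ of subsets of $E\setminus\{0\}$ (viewed as a subset of $2^{E\setminus\{0\}}$), there are a nonempty perfect $\mathcal{P}\subseteq\mathcal{A}$ and an infinite-dimensional subspace $V$ of $E$ such that either (i) for all $A\in\mathcal{P}$, $V\cap A=\emptyset$, or (ii) for all $A\in\mathcal{P}$, $A$ is asymptotic below $V$.
   Context: $F$ is a countable (possibly finite) field and $E$ is a countably infinite-dimensional $F$-vector space with a fixed basis. Subsets of $E\setminus\{0\}$ are identified with their characteristic functions, points of the Polish space $2^{E\setminus\{0\}}$ with the product topology. For a subset $A\subseteq E\setminus\{0\}$ and an infinite-dimensional subspace $V\subseteq E$, $A$ is asymptotic below $V$ if every infinite-dimensional subspace $W$ of $V$ satisfies $W\cap A\neq\emptyset$. *)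

theory Defs
  imports "HOL-Analysis.Analysis" "HOL-Library.Function_Algebras"
begin

text \<open>The field F is a type 'f of class field and countable (finite or countably infinite).
  E is the F-vector space of finitely supported functions nat \<Rightarrow> 'f
  (countably infinite dimensional, fixed basis = standard unit vectors).\<close>

definition scl :: "'f::field \<Rightarrow> (nat \<Rightarrow> 'f) \<Rightarrow> (nat \<Rightarrow> 'f)" where
  "scl c v = (\<lambda>n. c * v n)"

definition Espace :: "(nat \<Rightarrow> 'f::field) set" where
  "Espace = {v. finite {n. v n \<noteq> 0}}"

definition is_subspace :: "(nat \<Rightarrow> 'f::field) set \<Rightarrow> bool" where
  "is_subspace V \<longleftrightarrow> V \<subseteq> Espace \<and> module.subspace scl V"

definition infinite_dimensional :: "(nat \<Rightarrow> 'f::field) set \<Rightarrow> bool" where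
  "infinite_dimensional V \<longleftrightarrow> \<not> (\<exists>S. finite S \<and> S \<subseteq> V \<and> module.span scl S = V)"

definition asymptotic_below :: "(nat \<Rightarrow> 'f::field) set \<Rightarrow> (nat \<Rightarrow> 'f) set \<Rightarrow> bool" where
  "asymptotic_below A V \<longleftrightarrow>
     (\<forall>W. is_subspace W \<and> W \<subseteq> V \<and> infinite_dimensional W \<longrightarrow> W \<inter> A \<noteq> {})"

definition cantor_E :: "((nat \<Rightarrow> 'f::field) \<Rightarrow> bool) topology" where
  "cantor_E = product_topology (\<lambda>_. discrete_topology (UNIV :: bool set)) (Espace - {0})"

definition charfun :: "(nat \<Rightarrow> 'f::field) set \<Rightarrow> ((nat \<Rightarrow> 'f) \<Rightarrow> bool)" where
  "charfun A = restrict (\<lambda>x. x \<in> A) (Espace - {0})"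

definition baire_space :: "(nat \<Rightarrow> nat) topology" where
  "baire_space = product_topology (\<lambda>_. discrete_topology (UNIV :: nat set)) UNIV"

definition analytic_in :: "'a topology \<Rightarrow> 'a set \<Rightarrow> bool" where
  "analytic_in X S \<longleftrightarrow> S = {} \<or>
     (\<exists>f. continuous_map baire_space X f \<and> f ` topspace baire_space = S)"

definition perfect_in :: "'a topology \<Rightarrow> 'a set \<Rightarrow> bool" where
  "perfect_in X P \<longleftrightarrow> closedin X P \<and> P \<subseteq> X derived_set_of P"

end

theory Submission
  imports Defs
begin

text \<open>By Zorn's lemma, choose a maximal system \<open>S\<close> of pairs \<open>(A, W)\<close>, one for each of its sets \<open>A\<close>,
  with \<open>W\<close> an infinite-dimensional subspace disjoint from \<open>A\<close> such that finitely many of the \<open>W\<close>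
  always meet in infinite dimension.

  If \<open>S\<close> is countable, let \<open>V\<close> be a pseudo-intersection of its subspaces and let \<open>\<P>\<close> be a perfect
  subfamily of \<open>\<A>\<close> avoiding the countably many sets in \<open>S\<close>. A pair \<open>(A, W)\<close> with \<open>A \<in> \<P>\<close>, \<open>W \<subseteq> V\<close>
  and \<open>W \<inter> A = {}\<close> could be added to \<open>S\<close>; so every \<open>A \<in> \<P>\<close> is asymptotic below \<open>V\<close>.

  If \<open>S\<close> is uncountable, let \<open>\<G>\<close> be the family of finite intersections of its subspaces, and for a
  finite sequence \<open>a\<close> let \<open>Y a\<close> be the collection of the \<open>A\<close> disjoint from some \<open>W \<in> \<G>\<close> containing \<open>a\<close>.
  Suppose \<open>Y a\<close> is uncountable inside each of finitely many cylinders. Were every new vector \<open>v\<close> to make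
  \<open>Y (a @ [v])\<close> countable inside one of them, one could pick in each cylinder some \<open>A\<close> outside all the
  relevant countable sets; but the finitely many witnesses \<open>W\<close> have a common new vector.
  Hence a fusion of cylinders can be run while \<open>a\<close> grows to a sequence spanning \<open>V\<close>. Every branch is a
  limit of members of the \<open>Y a\<close>, and disjointness from a given vector is a closed condition, so all
  branches are disjoint from \<open>V\<close>.\<close>

section \<open>Infinite-dimensional subspaces\<close>

interpretation vs: vector_space "scl :: 'f::field \<Rightarrow> (nat \<Rightarrow> 'f) \<Rightarrow> (nat \<Rightarrow> 'f)"
  by unfold_locales (auto simp: scl_def fun_eq_iff algebra_simps)

lemma subspace_Espace: "vs.subspace Espace"
proof -
  have "finite {n. x n + y n \<noteq> 0}" if "finite {n. x n \<noteq> 0}" "finite {n. y n \<noteq> 0}"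
    for x y :: "nat \<Rightarrow> 'a"
    by (rule finite_subset[OF _ finite_UnI[OF that]]) auto
  moreover have "finite {n. c * x n \<noteq> 0}" if "finite {n. x n \<noteq> 0}" for c and x :: "nat \<Rightarrow> 'a"
    by (rule finite_subset[OF _ that]) auto
  ultimately show ?thesis
    by (auto simp: vs.subspace_def Espace_def scl_def)
qed

text \<open>A finitely supported vector is determined by a finite list of coordinates. This is where
  countability of the field enters.\<close>

lemma countable_Espace: "countable (Espace :: (nat \<Rightarrow> 'f::{field,countable}) set)"
proof (rule countable_subset)
  let ?vec = "\<lambda>l n. if n < length l then l ! n else 0"
  show "(Espace :: (nat \<Rightarrow> 'f) set) \<subseteq> range ?vec"
  proof
    fix v :: "nat \<Rightarrow> 'f"
    assume "v \<in> Espace"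
    then obtain m where "\<forall>n. v n \<noteq> 0 \<longrightarrow> n < m"
      using finite_nat_bounded[of "{n. v n \<noteq> 0}"] by (auto simp: Espace_def)
    then have "v = ?vec (map v [0..<m])"
      by (auto simp: fun_eq_iff)
    then show "v \<in> range ?vec"
      by (rule range_eqI)
  qed
qed simp

text \<open>The definition speaks only of finite \<open>S\<close> inside \<open>V\<close>; here
  \<open>S\<close> is any finite set. If \<open>V\<close> lay in its span, the exchange lemma would
  make a maximal independent subset of \<open>V\<close> finite, although it spans
  \<open>V\<close>.\<close>

lemma infinite_dimensionalD:
  assumes "infinite_dimensional V" "vs.subspace V" "finite S"
  shows "\<exists>v\<in>V. v \<notin> vs.span S"
proof (rule ccontr)
  assume "\<not> ?thesis"
  then have "V \<subseteq> vs.span S" by blast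
  obtain B where B: "B \<subseteq> V" "vs.independent B" "V \<subseteq> vs.span B"
    using vs.maximal_independent_subset[of V] by blast
  then have "finite B"
    using vs.independent_span_bound[OF \<open>finite S\<close>, of B] \<open>V \<subseteq> vs.span S\<close> by blast
  moreover have "vs.span B = V"
    using B assms(2) vs.span_minimal by blast
  ultimately show False
    using assms(1) B(1) by (auto simp: infinite_dimensional_def)
qed

lemma infinite_dimensionalI:
  assumes "\<And>S. finite S \<Longrightarrow> \<exists>v\<in>V. v \<notin> vs.span S"
  shows "infinite_dimensional V"
  using assms by (force simp: infinite_dimensional_def)

text \<open>A linear combination involves finitely many indices. The bound covers every later
  \<open>m\<close> because limit arguments supply an index that is only known to be large.\<close>

lemma in_span_initial_segment:
  assumes "w \<in> vs.span (range v)"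
  shows "\<exists>n::nat. \<forall>m\<ge>n. w \<in> vs.span (v ` {..<m})"
proof -
  obtain S where S: "finite S" "S \<subseteq> range v" "w \<in> vs.span S"
  proof -
    obtain S r where "finite S" "S \<subseteq> range v" "w = (\<Sum>a\<in>S. scl (r a) a)"
      using assms unfolding vs.span_explicit by blast
    then show ?thesis
      using that by (auto intro!: vs.span_sum vs.span_scale intro: vs.span_base)
  qed
  obtain I where I: "finite I" "S = v ` I"
    using S finite_subset_image by metis
  obtain n where "I \<subseteq> {..<n}"
    using finite_nat_bounded[OF I(1)] by blast
  then have "S \<subseteq> v ` {..<m}" if "n \<le> m" for m
    using that I(2) by fastforce
  then show ?thesis
    using S(3) vs.span_mono by blast
qed

text \<open>A finite spanning set would already lie in the span of some initial segment, which
  misses the next vector.\<close>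

lemma span_range_infinite_dimensional:
  assumes "\<And>n::nat. v n \<notin> vs.span (v ` {..<n})"
  shows "infinite_dimensional (vs.span (range v))"
proof -
  have False if S: "finite S" "S \<subseteq> vs.span (range v)" "vs.span S = vs.span (range v)" for S
  proof -
    obtain N where N: "\<And>s m. s \<in> S \<Longrightarrow> N s \<le> m \<Longrightarrow> s \<in> vs.span (v ` {..<m})"
      using in_span_initial_segment S(2) by (metis subsetD)
    define n where "n = Max (insert 0 (N ` S))"
    have "N s \<le> n" if "s \<in> S" for s
      using S(1) that by (auto simp: n_def)
    then have "S \<subseteq> vs.span (v ` {..<n})"
      using N by blast
    then have "vs.span S \<subseteq> vs.span (v ` {..<n})"
      using vs.span_minimal by blast
    then show False
      using assms[of n] S(3) vs.span_base[of "v n" "range v"] by auto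
  qed
  then show ?thesis
    by (auto simp: infinite_dimensional_def)
qed

text \<open>Modulo \<open>U\<close>, the space \<open>W\<close> has dimension at most one. So one
  fixed \<open>w0\<close> in \<open>W\<close> outside \<open>U\<close> corrects every vector of
  \<open>W\<close> into \<open>U\<close>, and a vector independent of \<open>w0\<close> and
  \<open>S\<close> stays outside the span of \<open>S\<close> after the correction.\<close>

lemma infinite_dimensional_Int_hyperplane:
  assumes W: "vs.subspace W" "infinite_dimensional W"
    and U: "vs.subspace U" "W \<subseteq> vs.span (insert b U)"
  shows "infinite_dimensional (W \<inter> U)"
proof (cases "W \<subseteq> U")
  case True
  then show ?thesis using W by (simp add: Int_absorb2)
next
  case False
  then obtain w0 where w0: "w0 \<in> W" "w0 \<notin> U" by blast
  have split: "\<exists>c. w - scl c b \<in> U" if "w \<in> W" for w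
    using that U(2) vs.span_breakdown_eq[of w b U] vs.span_eq_iff[THEN iffD2, OF U(1)] by auto
  obtain c0 where c0: "w0 - scl c0 b \<in> U" using split w0 by blast
  have "c0 \<noteq> 0" using c0 w0 by auto
  show ?thesis
  proof (rule infinite_dimensionalI)
    fix S :: "(nat \<Rightarrow> 'a) set"
    assume "finite S"
    then obtain w where w: "w \<in> W" "w \<notin> vs.span (insert w0 S)"
      using infinite_dimensionalD[OF W(2,1)] by blast
    obtain c where c: "w - scl c b \<in> U" using split w by blast
    \<comment> \<open>The factor \<open>c / c0\<close> cancels the components along
      \<open>b\<close>.\<close>
    define u where "u = w - scl (c / c0) w0"
    have "u = (w - scl c b) - scl (c / c0) (w0 - scl c0 b)"
      using \<open>c0 \<noteq> 0\<close> by (simp add: u_def fun_eq_iff scl_def field_simps)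
    then have "u \<in> U"
      using c c0 U(1) by (simp add: vs.subspace_diff vs.subspace_scale)
    moreover have "u \<in> W"
      using w w0 W(1) by (simp add: u_def vs.subspace_diff vs.subspace_scale)
    moreover have "u \<notin> vs.span S"
      using w(2) vs.span_breakdown_eq[of w w0 S] by (auto simp: u_def)
    ultimately show "\<exists>v\<in>W \<inter> U. v \<notin> vs.span S" by blast
  qed
qed

text \<open>The elements of \<open>B\<close> are removed one at a time: first cut \<open>W\<close>
  down to the span of \<open>U\<close> and the remaining vectors, then apply the induction
  hypothesis to the result.\<close>

lemma infinite_dimensional_Int_finite_codimension:
  assumes "finite B" "vs.subspace W" "infinite_dimensional W" "vs.subspace U"
    and "W \<subseteq> vs.span (B \<union> U)"
  shows "infinite_dimensional (W \<inter> U)"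
  using assms
proof (induction B arbitrary: W rule: finite_induct)
  case empty
  then have "W \<subseteq> U" by (metis Un_empty_left vs.span_eq_iff)
  then show ?case using empty by (simp add: Int_absorb2)
next
  case (insert b B)
  let ?U = "vs.span (B \<union> U)"
  have "vs.span (insert b (B \<union> U)) \<subseteq> vs.span (insert b ?U)"
    by (intro vs.span_mono) (auto intro: vs.span_base)
  then have "infinite_dimensional (W \<inter> ?U)"
    using insert.prems by (intro infinite_dimensional_Int_hyperplane[where b = b]) auto
  then have "infinite_dimensional (W \<inter> ?U \<inter> U)"
    using insert.prems by (intro insert.IH) (auto intro: vs.subspace_inter)
  moreover have "W \<inter> ?U \<inter> U = W \<inter> U"
    by (auto intro: vs.span_base)
  ultimately show ?case by simp
qed

lemma infinite_dimensional_Espace: "infinite_dimensional (Espace :: (nat \<Rightarrow> 'f::field) set)"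
proof (rule infinite_dimensionalI)
  fix S :: "(nat \<Rightarrow> 'f) set"
  assume "finite S"
  show "\<exists>v\<in>Espace. v \<notin> vs.span S"
  proof (rule ccontr)
    define e :: "nat \<Rightarrow> nat \<Rightarrow> 'f" where "e k = (\<lambda>n. if n = k then 1 else 0)" for k
    assume "\<not> ?thesis"
    moreover have "range e \<subseteq> Espace" by (auto simp: e_def Espace_def)
    ultimately have "range e \<subseteq> vs.span S" by blast
    have "e k \<notin> vs.span (e ` ({..<k}))" for k
    proof -
      have "vs.subspace {v. v k = 0}" by (auto simp: vs.subspace_def scl_def)
      then have "vs.span (e ` {..<k}) \<subseteq> {v. v k = 0}"
        by (intro vs.span_minimal) (auto simp: e_def)
      then show ?thesis by (auto simp: e_def)
    qed
    then have "infinite_dimensional (vs.span (range e))"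
      by (rule span_range_infinite_dimensional)
    then obtain v where "v \<in> vs.span (range e)" "v \<notin> vs.span S"
      using infinite_dimensionalD[OF _ vs.subspace_span \<open>finite S\<close>] by blast
    then show False
      using vs.span_minimal[OF \<open>range e \<subseteq> vs.span S\<close> vs.subspace_span] by blast
  qed
qed

section \<open>Intersections and pseudo-intersections of subspaces\<close>

lemma subspace_Espace_Int_Inter:
  assumes "\<And>W. W \<in> \<F> \<Longrightarrow> is_subspace W"
  shows "vs.subspace (Espace \<inter> \<Inter>\<F>)"
  using assms by (intro vs.subspace_inter subspace_Espace vs.subspace_Inter) (auto simp: is_subspace_def)

text \<open>Diagonalise: take the \<open>n\<close>-th generator of \<open>V\<close> from the
  intersection of the first \<open>n\<close> subspaces. A given finite intersection then contains
  all but finitely many generators, so it has finite codimension relative to \<open>V\<close> and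
  cuts every infinite-dimensional \<open>W\<close> inside \<open>V\<close> in infinite
  dimension.\<close>

lemma ex_pseudo_intersection:
  fixes \<W> :: "(nat \<Rightarrow> 'f::field) set set"
  assumes "countable \<W>" and sub: "\<forall>W\<in>\<W>. is_subspace W"
    and fip: "\<forall>\<F>\<subseteq>\<W>. finite \<F> \<longrightarrow> infinite_dimensional (Espace \<inter> \<Inter>\<F>)"
  shows "\<exists>V. is_subspace V \<and> infinite_dimensional V \<and>
    (\<forall>W \<F>. is_subspace W \<and> infinite_dimensional W \<and> W \<subseteq> V \<and> finite \<F> \<and> \<F> \<subseteq> \<W> \<longrightarrow>
      infinite_dimensional (W \<inter> (Espace \<inter> \<Inter>\<F>)))"
proof -
  have Esub: "is_subspace (Espace :: (nat \<Rightarrow> 'f) set)"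
    by (simp add: is_subspace_def subspace_Espace)
  \<comment> \<open>Adjoining \<open>Espace\<close> makes the family nonempty, so that it has an
    enumeration by the naturals.\<close>
  obtain w :: "nat \<Rightarrow> (nat \<Rightarrow> 'f) set" where w: "range w = insert Espace \<W>"
    using assms(1) range_from_nat_into[of "insert Espace \<W>"] by (metis countable_insert insert_not_empty)
  \<comment> \<open>For \<open>n = 0\<close> the bare intersection would contain functions of
    infinite support; hence the factor \<open>Espace\<close>.\<close>
  define U where "U n = Espace \<inter> \<Inter>(w ` {..<n})" for n
  have "is_subspace (w k)" for k
  proof -
    have "w k \<in> insert Espace \<W>" using w by blast
    then show ?thesis using sub Esub by auto
  qed
  then have U_sub: "vs.subspace (U n)" for n
    unfolding U_def by (intro subspace_Espace_Int_Inter) auto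
  have U_inf: "infinite_dimensional (U n)" for n
  proof -
    have "U n = Espace \<inter> \<Inter>(w ` {..<n} - {Espace})" by (auto simp: U_def)
    also have "infinite_dimensional \<dots>" using w by (intro fip[rule_format]) auto
    finally show ?thesis .
  qed
  have "\<exists>L. \<forall>n. (n = 0 \<longrightarrow> L n = []) \<and>
      (\<exists>v\<in>U n. v \<notin> vs.span (set (L n)) \<and> L (Suc n) = L n @ [v])"
  proof (rule dependent_nat_choice)
    fix L :: "(nat \<Rightarrow> 'f) list" and n
    obtain v where "v \<in> U n" "v \<notin> vs.span (set L)"
      using infinite_dimensionalD[OF U_inf U_sub] by blast
    then show "\<exists>L'. (Suc n = 0 \<longrightarrow> L' = []) \<and> (\<exists>v\<in>U n. v \<notin> vs.span (set L) \<and> L' = L @ [v])"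
      by blast
  qed auto
  then obtain L where L: "\<And>n. \<exists>v\<in>U n. v \<notin> vs.span (set (L n)) \<and> L (Suc n) = L n @ [v]"
    and L0: "L 0 = []" by blast
  obtain v where v: "\<And>n. v n \<in> U n" "\<And>n. v n \<notin> vs.span (set (L n))" "\<And>n. L (Suc n) = L n @ [v n]"
    using L by metis
  have set_L: "set (L n) = v ` {..<n}" for n
    by (induction n) (use L0 v(3) in \<open>auto simp: lessThan_Suc\<close>)
  let ?V = "vs.span (range v)"
  show ?thesis
  proof (intro exI[of _ ?V] conjI allI impI)
    have "range v \<subseteq> Espace" using v(1) by (auto simp: U_def)
    then have "?V \<subseteq> Espace" using vs.span_minimal subspace_Espace by blast
    then show "is_subspace ?V" by (simp add: is_subspace_def)
    show "infinite_dimensional ?V"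
      using v(2) by (intro span_range_infinite_dimensional) (simp add: set_L)
  next
    fix W \<F>
    assume "is_subspace W \<and> infinite_dimensional W \<and> W \<subseteq> ?V \<and> finite \<F> \<and> \<F> \<subseteq> \<W>"
    then have W: "is_subspace W" "infinite_dimensional W" "W \<subseteq> ?V" and \<F>: "finite \<F>" "\<F> \<subseteq> \<W>"
      by auto
    obtain I where I: "finite I" "\<F> = w ` I"
      using \<F> w finite_subset_image[of \<F> w UNIV] by auto
    obtain n where n: "I \<subseteq> {..<n}" using finite_nat_bounded[OF I(1)] by blast
    have "range v \<subseteq> v ` {..<n} \<union> (Espace \<inter> \<Inter>\<F>)"
    proof
      fix x assume "x \<in> range v"
      then obtain k where k: "x = v k" by blast
      show "x \<in> v ` {..<n} \<union> (Espace \<inter> \<Inter>\<F>)"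
      proof (cases "k < n")
        case False
        then have "I \<subseteq> {..<k}" using n by auto
        then show ?thesis using v(1)[of k] k I(2) by (auto simp: U_def)
      qed (use k in auto)
    qed
    then have "W \<subseteq> vs.span (v ` {..<n} \<union> (Espace \<inter> \<Inter>\<F>))"
      using W(3) vs.span_mono by blast
    then show "infinite_dimensional (W \<inter> (Espace \<inter> \<Inter>\<F>))"
      using W sub \<F> by (intro infinite_dimensional_Int_finite_codimension[of "v ` {..<n}"]
        subspace_Espace_Int_Inter) (auto simp: is_subspace_def)
  qed
qed

section \<open>Perfect sets from fusion trees\<close>

text \<open>Coding by a full point and a length, rather than by a finite sequence, makes the centre
  \<open>fst p\<close> itself a point of the cylinder.\<close>

definition cylinder :: "(nat \<Rightarrow> nat) \<times> nat \<Rightarrow> (nat \<Rightarrow> nat) set" where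
  "cylinder p = {w. \<forall>i<snd p. w i = fst p i}"

lemma countable_cylinders: "countable (range cylinder)"
proof (rule countable_subset)
  let ?C = "\<lambda>l. cylinder (\<lambda>i. l ! i, length l)"
  show "range cylinder \<subseteq> range ?C"
  proof
    fix N assume "N \<in> range cylinder"
    then obtain z m where "N = cylinder (z, m)" by auto
    then have "N = ?C (map z [0..<m])" by (auto simp: cylinder_def)
    then show "N \<in> range ?C" by (rule range_eqI)
  qed
qed simp

section \<open>Finite-coordinate descriptions of open sets and continuity\<close>

lemma topspace_cantor_E: "topspace cantor_E = extensional (Espace - {0})"
  by (auto simp: cantor_E_def PiE_def)

lemma openin_cantor_ED:
  assumes "openin cantor_E U" "y \<in> U"
  shows "\<exists>F. finite F \<and> F \<subseteq> Espace - {0} \<and>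
    (\<forall>y'\<in>topspace cantor_E. (\<forall>j\<in>F. y' j = y j) \<longrightarrow> y' \<in> U)"
proof -
  obtain X where X: "finite {i \<in> Espace - {0}. X i \<noteq> UNIV}"
      "y \<in> Pi\<^sub>E (Espace - {0}) X" "Pi\<^sub>E (Espace - {0}) X \<subseteq> U"
    using assms unfolding cantor_E_def openin_product_topology_alt by auto
  show ?thesis
  proof (intro exI conjI ballI impI)
    show "finite {i \<in> Espace - {0}. X i \<noteq> UNIV}" by (rule X(1))
    fix y' assume "y' \<in> topspace cantor_E"
      and *: "\<forall>j\<in>{i \<in> Espace - {0}. X i \<noteq> UNIV}. y' j = y j"
    have "y' j \<in> X j" if "j \<in> Espace - {0}" for j
      using *[rule_format, of j] that X(2) by (cases "X j = UNIV") (auto simp: PiE_def Pi_def)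
    then have "y' \<in> Pi\<^sub>E (Espace - {0}) X"
      using \<open>y' \<in> topspace cantor_E\<close> unfolding topspace_cantor_E PiE_def Pi_def by blast
    then show "y' \<in> U" using X(3) by blast
  qed auto
qed

text \<open>Each coordinate of \<open>f\<close> is a continuous map to a discrete space, hence
  locally constant.\<close>

lemma continuous_map_baire_cantor_ED:
  assumes "continuous_map baire_space cantor_E f" "j \<in> Espace - {0}"
  shows "\<exists>m. \<forall>w\<in>cylinder (z, m). f w j = f z j"
proof -
  have "continuous_map baire_space (discrete_topology UNIV) (\<lambda>z. f z j)"
    using assms unfolding cantor_E_def continuous_map_componentwise by auto
  then have "openin baire_space {w \<in> topspace baire_space. f w j \<in> {f z j}}"
    by (rule openin_continuous_map_preimage) simp
  moreover have "z \<in> {w \<in> topspace baire_space. f w j \<in> {f z j}}"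
    by (simp add: baire_space_def)
  ultimately obtain X where X: "finite {i. X i \<noteq> (UNIV::nat set)}"
      "z \<in> Pi\<^sub>E UNIV X" "Pi\<^sub>E UNIV X \<subseteq> {w. f w j = f z j}"
    unfolding baire_space_def openin_product_topology_alt by auto
  obtain m where m: "{i. X i \<noteq> (UNIV::nat set)} \<subseteq> {..<m}"
    using finite_nat_bounded[OF X(1)] by blast
  have "w \<in> Pi\<^sub>E UNIV X" if "w \<in> cylinder (z, m)" for w
  proof -
    have "w i \<in> X i" for i
    proof (cases "i < m")
      case True
      then show ?thesis using that X(2) by (auto simp: cylinder_def PiE_def Pi_def)
    next
      case False
      then have "X i = UNIV" using m by auto
      then show ?thesis by simp
    qed
    then show ?thesis by auto
  qed
  then show ?thesis using X(3) by blast
qed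

lemma continuous_map_baire_cantor_E_finite:
  assumes "continuous_map baire_space cantor_E f" "finite F" "F \<subseteq> Espace - {0}"
  shows "\<exists>m. \<forall>k\<ge>m. \<forall>w\<in>cylinder (z, k). \<forall>j\<in>F. f w j = f z j"
proof -
  have "\<forall>j\<in>F. \<exists>m. \<forall>w\<in>cylinder (z, m). f w j = f z j"
    using continuous_map_baire_cantor_ED[OF assms(1)] assms(3) by blast
  then obtain M where M: "\<forall>j\<in>F. \<forall>w\<in>cylinder (z, M j). f w j = f z j"
    by (rule bchoice[THEN exE])
  \<comment> \<open>The inserted 0 keeps the maximum meaningful for empty \<open>F\<close>.\<close>
  have "M j \<le> Max (insert 0 (M ` F))" if "j \<in> F" for j
    using that assms(2) by simp
  then show ?thesis
    by (intro exI[of _ "Max (insert 0 (M ` F))"] allI impI ballI M[rule_format])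
      (auto simp: cylinder_def dest: less_le_trans order_trans)
qed

text \<open>Only countably many values of \<open>Y\<close> are attained on cylinders with countable trace, because there
  are only countably many cylinders; any two other values yield a splitting.\<close>

lemma uncountable_split_cylinder:
  assumes cont: "continuous_map baire_space cantor_E f"
    and unc: "uncountable (Y \<inter> f ` cylinder p)"
    and d: "d \<in> topspace cantor_E"
  shows "\<exists>q0 q1. cylinder q0 \<subseteq> cylinder p \<and> cylinder q1 \<subseteq> cylinder p \<and> n \<le> snd q0 \<and> n \<le> snd q1 \<and>
    uncountable (Y \<inter> f ` cylinder q0) \<and> uncountable (Y \<inter> f ` cylinder q1) \<and>
    (\<exists>j\<in>Espace - {0}. \<forall>z\<in>cylinder q0. \<forall>w\<in>cylinder q1. f z j \<noteq> f w j) \<and>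
    d \<notin> f ` cylinder q0 \<and> d \<notin> f ` cylinder q1"
proof -
  have ext: "f z \<in> extensional (Espace - {0})" for z
    using cont by (auto simp: continuous_map_def topspace_cantor_E baire_space_def Pi_def)
  have separate: "\<exists>j\<in>Espace - {0}. y j \<noteq> y' j"
    if "y \<in> extensional (Espace - {0})" "y' \<in> extensional (Espace - {0})" "y \<noteq> y'"
    for y y' :: "(nat \<Rightarrow> 'a) \<Rightarrow> bool"
    using extensionalityI[OF that(1,2)] that(3) by blast
  define \<N> where "\<N> = {N \<in> range cylinder. countable (Y \<inter> f ` N)}"
  define C where "C = (\<Union>N\<in>\<N>. Y \<inter> f ` N)"
  have "countable C"
    unfolding C_def \<N>_def by (intro countable_UN countable_subset[OF _ countable_cylinders]) auto
  then have *: "uncountable (Y \<inter> f ` cylinder p - C - {d})"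
    using unc by (metis countable_Un_iff uncountable_minus_countable countable_insert countable_empty)
  then obtain y0 where y0: "y0 \<in> Y \<inter> f ` cylinder p - C - {d}"
    by (metis countable_empty ex_in_conv)
  obtain y1 where y1: "y1 \<in> Y \<inter> f ` cylinder p - C - {d}" "y1 \<noteq> y0"
    using * by (metis countable_empty countable_insert countable_subset subsetI insertI1)
  obtain z0 where z0: "z0 \<in> cylinder p" "f z0 = y0" using y0 by blast
  obtain z1 where z1: "z1 \<in> cylinder p" "f z1 = y1" using y1 by blast
  obtain j where j: "j \<in> Espace - {0}" "y0 j \<noteq> y1 j"
    using separate[of y0 y1] ext z0 z1 y1(2) by metis
  obtain j0 where j0: "j0 \<in> Espace - {0}" "y0 j0 \<noteq> d j0"
    using separate[of y0 d] ext[of z0] z0(2) y0 d by (auto simp: topspace_cantor_E)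
  obtain j1 where j1: "j1 \<in> Espace - {0}" "y1 j1 \<noteq> d j1"
    using separate[of y1 d] ext[of z1] z1(2) y1 d by (auto simp: topspace_cantor_E)
  \<comment> \<open>These three coordinates tell \<open>y0\<close> from \<open>y1\<close> and both
    of them from \<open>d\<close>.\<close>
  define F where "F = {j, j0, j1}"
  have F: "finite F" "F \<subseteq> Espace - {0}" "j \<in> F" "j0 \<in> F" "j1 \<in> F"
    using j(1) j0(1) j1(1) by (auto simp: F_def)
  obtain m0 where m0: "\<forall>k\<ge>m0. \<forall>w\<in>cylinder (z0, k). \<forall>j\<in>F. f w j = f z0 j"
    using continuous_map_baire_cantor_E_finite[OF cont F(1,2)] by blast
  obtain m1 where m1: "\<forall>k\<ge>m1. \<forall>w\<in>cylinder (z1, k). \<forall>j\<in>F. f w j = f z1 j"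
    using continuous_map_baire_cantor_E_finite[OF cont F(1,2)] by blast
  \<comment> \<open>The summands give, in turn, the required length, constancy on \<open>F\<close>
    around \<open>z0\<close> and around \<open>z1\<close>, and containment in
    \<open>cylinder p\<close>.\<close>
  define m where "m = n + m0 + m1 + snd p"
  have f0: "f w j = y0 j" if "w \<in> cylinder (z0, m)" "j \<in> F" for w j
    using m0[rule_format, of m w j] that z0(2) by (simp add: m_def)
  have f1: "f w j = y1 j" if "w \<in> cylinder (z1, m)" "j \<in> F" for w j
    using m1[rule_format, of m w j] that z1(2) by (simp add: m_def)
  have unc': "uncountable (Y \<inter> f ` cylinder (z, m))" if "f z \<in> Y" "f z \<notin> C" for z
  proof
    assume "countable (Y \<inter> f ` cylinder (z, m))"
    then have "cylinder (z, m) \<in> \<N>" by (simp add: \<N>_def)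
    moreover have "z \<in> cylinder (z, m)" by (simp add: cylinder_def)
    ultimately show False using that by (auto simp: C_def)
  qed
  show ?thesis
  proof (intro exI conjI)
    show "cylinder (z0, m) \<subseteq> cylinder p" "cylinder (z1, m) \<subseteq> cylinder p"
      using z0 z1 by (auto simp: cylinder_def m_def)
    show "uncountable (Y \<inter> f ` cylinder (z0, m))" "uncountable (Y \<inter> f ` cylinder (z1, m))"
      using unc' y0 y1 z0 z1 by auto
    have "f z j \<noteq> f w j" if "z \<in> cylinder (z0, m)" "w \<in> cylinder (z1, m)" for z w
      using f0[OF that(1) F(3)] f1[OF that(2) F(3)] j(2) by simp
    then show "\<exists>j\<in>Espace - {0}. \<forall>z\<in>cylinder (z0, m). \<forall>w\<in>cylinder (z1, m). f z j \<noteq> f w j"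
      using j(1) by blast
    show "d \<notin> f ` cylinder (z0, m)" using f0[OF _ F(4)] j0(2) by blast
    show "d \<notin> f ` cylinder (z1, m)" using f1[OF _ F(5)] j1(2) by blast
  qed (simp_all add: m_def)
qed

text \<open>The image is closed as a compact subset of a Hausdorff space. It has no isolated points,
  since changing one far bit of \<beta> moves the value by injectivity but alters none of finitely
  many prescribed coordinates.\<close>

lemma perfect_in_cantor_E_image:
  fixes G :: "(nat \<Rightarrow> bool) \<Rightarrow> ((nat \<Rightarrow> 'f::field) \<Rightarrow> bool)"
  assumes ext: "\<And>\<beta>. G \<beta> \<in> topspace cantor_E" and "inj G"
    and cont: "\<And>j \<beta>. j \<in> Espace - {0} \<Longrightarrow> \<exists>n. \<forall>\<beta>'. (\<forall>i<n. \<beta>' i = \<beta> i) \<longrightarrow> G \<beta>' j = G \<beta> j"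
  shows "perfect_in cantor_E (range G)"
proof -
  let ?C = "product_topology (\<lambda>_::nat. discrete_topology (UNIV :: bool set)) UNIV"
  have "continuous_map ?C (discrete_topology UNIV) (\<lambda>\<beta>. G \<beta> j)" if j: "j \<in> Espace - {0}" for j
  proof -
    have "openin ?C {\<beta>. G \<beta> j \<in> U}" for U
    proof (subst openin_subopen, intro ballI)
      fix \<beta> assume \<beta>: "\<beta> \<in> {\<beta>. G \<beta> j \<in> U}"
      obtain n where n: "\<forall>\<beta>'. (\<forall>i<n. \<beta>' i = \<beta> i) \<longrightarrow> G \<beta>' j = G \<beta> j"
        using cont[OF j] by blast
      let ?X = "\<lambda>i. if i < n then {\<beta> i} else UNIV"
      have "finite {i. ?X i \<noteq> UNIV}"
        by (rule finite_subset[of _ "{..<n}"]) auto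
      then have "openin ?C (Pi\<^sub>E UNIV ?X)"
        by (intro product_topology_basis) auto
      moreover have "\<beta> \<in> Pi\<^sub>E UNIV ?X" by (rule PiE_I) auto
      moreover have "Pi\<^sub>E UNIV ?X \<subseteq> {\<beta>. G \<beta> j \<in> U}"
      proof
        fix \<beta>' assume *: "\<beta>' \<in> Pi\<^sub>E UNIV ?X"
        have "\<beta>' i = \<beta> i" if "i < n" for i
          using PiE_mem[OF *, of i] that by simp
        then have "G \<beta>' j = G \<beta> j" using n by blast
        then show "\<beta>' \<in> {\<beta>. G \<beta> j \<in> U}" using \<beta> by simp
      qed
      ultimately show "\<exists>T. openin ?C T \<and> \<beta> \<in> T \<and> T \<subseteq> {\<beta>. G \<beta> j \<in> U}" by blast
    qed
    then show ?thesis by (simp add: continuous_map_def)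
  qed
  then have "continuous_map ?C cantor_E G"
    using ext unfolding cantor_E_def continuous_map_componentwise by (auto simp: PiE_def)
  moreover have "compact_space ?C"
    by (simp add: compact_space_product_topology compact_space_discrete_topology)
  ultimately have "compactin cantor_E (range G)"
    using image_compactin[of ?C UNIV cantor_E G] by (simp add: compact_space_def)
  moreover have "Hausdorff_space cantor_E"
    by (simp add: cantor_E_def Hausdorff_space_product_topology)
  ultimately have "closedin cantor_E (range G)"
    using compactin_imp_closedin by blast
  moreover have "range G \<subseteq> cantor_E derived_set_of (range G)"
  proof
    fix y assume "y \<in> range G"
    then obtain \<beta> where y: "y = G \<beta>" by blast
    have "\<exists>y'. y' \<noteq> y \<and> y' \<in> range G \<and> y' \<in> U" if U: "openin cantor_E U" "y \<in> U" for U
    proof -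
      obtain F where F: "finite F" "F \<subseteq> Espace - {0}"
        "\<forall>y'\<in>topspace cantor_E. (\<forall>j\<in>F. y' j = y j) \<longrightarrow> y' \<in> U"
        using openin_cantor_ED[OF U] by blast
      have "\<forall>j\<in>F. \<exists>n. \<forall>\<beta>'. (\<forall>i<n. \<beta>' i = \<beta> i) \<longrightarrow> G \<beta>' j = G \<beta> j"
        using cont F(2) by blast
      then obtain n where "\<forall>j\<in>F. \<forall>\<beta>'. (\<forall>i<n j. \<beta>' i = \<beta> i) \<longrightarrow> G \<beta>' j = G \<beta> j"
        by (rule bchoice[THEN exE])
      then have n: "G \<beta>' j = G \<beta> j" if "j \<in> F" "\<forall>i<n j. \<beta>' i = \<beta> i" for j \<beta>'
        using that by blast
      define k where "k = Max (insert 0 (n ` F))"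
      have k: "n j \<le> k" if "j \<in> F" for j
        using that F(1) by (simp add: k_def)
      \<comment> \<open>Position \<open>k\<close> lies beyond all bits that decide the coordinates
        in \<open>F\<close>.\<close>
      define \<beta>' where "\<beta>' = \<beta>(k := \<not> \<beta> k)"
      have "\<beta>' \<noteq> \<beta>" by (auto simp: \<beta>'_def fun_eq_iff)
      then have "G \<beta>' \<noteq> y" using \<open>inj G\<close> y by (auto dest: injD)
      moreover have "G \<beta>' j = y j" if "j \<in> F" for j
        unfolding y using k[OF that] by (intro n[OF that]) (auto simp: \<beta>'_def)
      then have "G \<beta>' \<in> U" using F(3) ext by blast
      ultimately show ?thesis by blast
    qed
    then show "y \<in> cantor_E derived_set_of (range G)"
      using ext y by (auto simp: derived_set_of_def)
  qed
  ultimately show ?thesis by (simp add: perfect_in_def)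
qed

lemma perfect_fusion:
  fixes f :: "(nat \<Rightarrow> nat) \<Rightarrow> ((nat \<Rightarrow> 'f::field) \<Rightarrow> bool)"
    and Y :: "'s \<Rightarrow> ((nat \<Rightarrow> 'f) \<Rightarrow> bool) set" and d :: "nat \<Rightarrow> ((nat \<Rightarrow> 'f) \<Rightarrow> bool)"
  assumes f: "continuous_map baire_space cantor_E f"
    and start: "uncountable (Y \<tau> \<inter> range f)"
    and step: "\<forall>\<sigma> \<N>. finite \<N> \<longrightarrow> (\<forall>N\<in>\<N>. uncountable (Y \<sigma> \<inter> f ` N)) \<longrightarrow>
      (\<exists>\<sigma>'. R \<sigma> \<sigma>' \<and> (\<forall>N\<in>\<N>. uncountable (Y \<sigma>' \<inter> f ` N)))"
    and d: "range d \<subseteq> topspace cantor_E"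
  shows "\<exists>P \<sigma>. \<sigma> 0 = \<tau> \<and> (\<forall>n. R (\<sigma> n) (\<sigma> (Suc n))) \<and>
    P \<noteq> {} \<and> P \<subseteq> range f \<and> perfect_in cantor_E P \<and> P \<inter> range d = {} \<and>
    (\<forall>y\<in>P. \<forall>F n. finite F \<and> F \<subseteq> Espace - {0} \<longrightarrow> (\<exists>k\<ge>n. \<exists>y'\<in>Y (\<sigma> k). \<forall>j\<in>F. y' j = y j))"
proof -
  \<comment> \<open>The map in the second component is total, but at stage \<open>n\<close> only
    lists of length \<open>n\<close> count. The clause for 0 fixes the initial state within the
    dependent choice.\<close>
  define I where "I n \<Phi> \<longleftrightarrow> (n = 0 \<longrightarrow> fst \<Phi> = \<tau>) \<and>
      (\<forall>t. length t = n \<longrightarrow> uncountable (Y (fst \<Phi>) \<inter> f ` cylinder (snd \<Phi> t)))"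
    for n and \<Phi> :: "'s \<times> (bool list \<Rightarrow> (nat \<Rightarrow> nat) \<times> nat)"
  define T where "T n S S' \<longleftrightarrow> (\<forall>t. length t = n \<longrightarrow>
      (\<forall>b. cylinder (S' (t @ [b])) \<subseteq> cylinder (S t) \<and> Suc n \<le> snd (S' (t @ [b])) \<and>
           d n \<notin> f ` cylinder (S' (t @ [b]))) \<and>
      (\<exists>j\<in>Espace - {0}. \<forall>z\<in>cylinder (S' (t @ [False])). \<forall>w\<in>cylinder (S' (t @ [True])). f z j \<noteq> f w j))"
    for n and S S' :: "bool list \<Rightarrow> (nat \<Rightarrow> nat) \<times> nat"
  have "\<exists>\<Phi>. \<forall>n. I n (\<Phi> n) \<and> (R (fst (\<Phi> n)) (fst (\<Phi> (Suc n))) \<and> T n (snd (\<Phi> n)) (snd (\<Phi> (Suc n))))"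
  proof (rule dependent_nat_choice)
    have "cylinder (\<lambda>_. 0, 0) = UNIV" by (simp add: cylinder_def)
    then show "\<exists>\<Phi>. I 0 \<Phi>"
      using start by (intro exI[of _ "(\<tau>, \<lambda>_. (\<lambda>_. 0, 0))"]) (simp add: I_def)
  next
    fix \<Phi> n
    assume I: "I n \<Phi>"
    obtain \<sigma> S where \<Phi>: "\<Phi> = (\<sigma>, S)" by fastforce
    have "finite {t :: bool list. length t = n}"
      using finite_lists_length_eq[of "UNIV :: bool set" n] by simp
    then have "\<exists>\<sigma>'. R \<sigma> \<sigma>' \<and> (\<forall>N\<in>(\<lambda>t. cylinder (S t)) ` {t. length t = n}. uncountable (Y \<sigma>' \<inter> f ` N))"
      using I by (intro step[rule_format]) (auto simp: \<Phi> I_def)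
    then obtain \<sigma>' where \<sigma>': "R \<sigma> \<sigma>'" "\<And>t. length t = n \<Longrightarrow> uncountable (Y \<sigma>' \<inter> f ` cylinder (S t))"
      by auto
    define good where "good t q \<longleftrightarrow>
        cylinder (fst q) \<subseteq> cylinder (S t) \<and> cylinder (snd q) \<subseteq> cylinder (S t) \<and>
        Suc n \<le> snd (fst q) \<and> Suc n \<le> snd (snd q) \<and>
        uncountable (Y \<sigma>' \<inter> f ` cylinder (fst q)) \<and> uncountable (Y \<sigma>' \<inter> f ` cylinder (snd q)) \<and>
        (\<exists>j\<in>Espace - {0}. \<forall>z\<in>cylinder (fst q). \<forall>w\<in>cylinder (snd q). f z j \<noteq> f w j) \<and>
        d n \<notin> f ` cylinder (fst q) \<and> d n \<notin> f ` cylinder (snd q)" for t q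
    have "\<exists>q. good t q" if t: "length t = n" for t
    proof -
      have "\<exists>q0 q1. good t (q0, q1)"
        unfolding good_def fst_conv snd_conv using d
        by (intro uncountable_split_cylinder[OF f \<sigma>'(2)[OF t]]) blast
      then show ?thesis by blast
    qed
    then obtain q where q: "\<And>t. length t = n \<Longrightarrow> good t (q t)" by metis
    \<comment> \<open>The last bit of a node selects one half of the pair chosen for its
      parent.\<close>
    define S' where "S' t = (if last t then snd else fst) (q (butlast t))" for t
    have S'_simps: "S' (t @ [b]) = (if b then snd else fst) (q t)" for t b
      by (simp add: S'_def)
    have "uncountable (Y \<sigma>' \<inter> f ` cylinder (S' t))" if "length t = Suc n" for t
      using that q[of "butlast t"] by (simp add: S'_def good_def)
    then have "I (Suc n) (\<sigma>', S')" by (simp add: I_def)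
    moreover have "T n S S'"
      unfolding T_def
    proof (intro allI impI)
      fix t :: "bool list"
      assume "length t = n"
      from q[OF this] show "(\<forall>b. cylinder (S' (t @ [b])) \<subseteq> cylinder (S t) \<and> Suc n \<le> snd (S' (t @ [b])) \<and>
           d n \<notin> f ` cylinder (S' (t @ [b]))) \<and>
        (\<exists>j\<in>Espace - {0}. \<forall>z\<in>cylinder (S' (t @ [False])). \<forall>w\<in>cylinder (S' (t @ [True])). f z j \<noteq> f w j)"
        unfolding good_def S'_simps by simp
    qed
    ultimately show "\<exists>\<Phi>'. I (Suc n) \<Phi>' \<and> (R (fst \<Phi>) (fst \<Phi>') \<and> T n (snd \<Phi>) (snd \<Phi>'))"
      using \<sigma>'(1) by (intro exI[of _ "(\<sigma>', S')"]) (simp add: \<Phi>)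
  qed
  then obtain \<Phi> where \<Phi>: "\<And>n. I n (\<Phi> n)" "\<And>n. R (fst (\<Phi> n)) (fst (\<Phi> (Suc n)))"
      "\<And>n. T n (snd (\<Phi> n)) (snd (\<Phi> (Suc n)))"
    by blast
  define \<sigma> where "\<sigma> n = fst (\<Phi> n)" for n
  \<comment> \<open>Reading each node at the stage given by its length merges all stages into one
    tree.\<close>
  define p where "p t = snd (\<Phi> (length t)) t" for t
  have unc: "uncountable (Y (\<sigma> (length t)) \<inter> f ` cylinder (p t))" for t
    using \<Phi>(1)[of "length t"] by (simp add: I_def \<sigma>_def p_def)
  have sub: "cylinder (p (t @ [b])) \<subseteq> cylinder (p t)"
    and avoid: "d (length t) \<notin> f ` cylinder (p (t @ [b]))"
    and long: "Suc (length t) \<le> snd (p (t @ [b]))" for t b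
    using \<Phi>(3)[of "length t"] by (auto simp: T_def p_def)
  have separate: "\<exists>j\<in>Espace - {0}. \<forall>z\<in>cylinder (p (t @ [False])). \<forall>w\<in>cylinder (p (t @ [True])). f z j \<noteq> f w j" for t
    using \<Phi>(3)[of "length t"] by (simp add: T_def p_def)
  define r where "r \<beta> n = map \<beta> [0..<n]" for \<beta> :: "nat \<Rightarrow> bool" and n
  have r_Suc: "r \<beta> (Suc n) = r \<beta> n @ [\<beta> n]" and length_r: "length (r \<beta> n) = n" for \<beta> n
    by (auto simp: r_def)
  have long': "n \<le> snd (p (r \<beta> n))" for \<beta> n
    using long[of "r \<beta> (n - 1)" "\<beta> (n - 1)"] by (cases n) (auto simp: r_Suc length_r)
  have mono: "cylinder (p (r \<beta> m)) \<subseteq> cylinder (p (r \<beta> n))" if "n \<le> m" for \<beta> m n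
    using that
  proof (induction rule: dec_induct)
    case (step k)
    then show ?case using sub[of "r \<beta> k" "\<beta> k"] by (auto simp: r_Suc)
  qed simp
  \<comment> \<open>Node \<open>Suc i\<close> of the branch is the first one whose cylinder is
    guaranteed to fix coordinate \<open>i\<close>.\<close>
  define z where "z \<beta> i = fst (p (r \<beta> (Suc i))) i" for \<beta> i
  have z_in: "z \<beta> \<in> cylinder (p (r \<beta> n))" for \<beta> n
  proof -
    have "z \<beta> i = fst (p (r \<beta> n)) i" if "i < snd (p (r \<beta> n))" for i
    proof -
      \<comment> \<open>The centre of a node below both nodes lies in both cylinders and compares
        them.\<close>
      let ?w = "fst (p (r \<beta> (max n (Suc i))))"
      have "?w \<in> cylinder (p (r \<beta> (max n (Suc i))))" by (simp add: cylinder_def)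
      then have "?w \<in> cylinder (p (r \<beta> n))" "?w \<in> cylinder (p (r \<beta> (Suc i)))"
        using mono[of n "max n (Suc i)" \<beta>] mono[of "Suc i" "max n (Suc i)" \<beta>] by auto
      then have "?w i = fst (p (r \<beta> n)) i" "?w i = z \<beta> i"
        using that long'[of "Suc i" \<beta>] by (auto simp: cylinder_def z_def)
      then show ?thesis by simp
    qed
    then show ?thesis by (simp add: cylinder_def)
  qed
  have near: "w \<in> cylinder (z \<beta>, n)" if "w \<in> cylinder (p (r \<beta> n))" for w \<beta> n
    using that z_in[of \<beta> n] long'[of n \<beta>] by (simp add: cylinder_def)
  define G where "G \<beta> = f (z \<beta>)" for \<beta>
  have fsep: "f (z \<beta>) \<noteq> f (z \<beta>')" if "r \<beta> k = r \<beta>' k" "\<not> \<beta> k" "\<beta>' k" for \<beta> \<beta>' k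
    using separate[of "r \<beta> k"] z_in[of \<beta> "Suc k"] z_in[of \<beta>' "Suc k"] that
    unfolding r_Suc by fastforce
  have "inj G"
  proof (rule injI, rule ccontr)
    fix \<beta> \<beta>' assume eq: "G \<beta> = G \<beta>'" and "\<beta> \<noteq> \<beta>'"
    then have ex: "\<exists>k. \<beta> k \<noteq> \<beta>' k" by auto
    \<comment> \<open>At the first difference the branches pass into sibling cylinders, which a
      coordinate of \<open>f\<close> separates.\<close>
    define k where "k = (LEAST k. \<beta> k \<noteq> \<beta>' k)"
    have "\<beta> k \<noteq> \<beta>' k" unfolding k_def using ex by (rule LeastI_ex)
    moreover have "\<beta> i = \<beta>' i" if "i < k" for i
      using not_less_Least that unfolding k_def by blast
    then have "r \<beta> k = r \<beta>' k" by (simp add: r_def)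
    ultimately show False
      using fsep[of \<beta> k \<beta>'] fsep[of \<beta>' k \<beta>] eq by (auto simp: G_def)
  qed
  have G_top: "G \<beta> \<in> topspace cantor_E" for \<beta>
    using f by (auto simp: G_def continuous_map_def baire_space_def Pi_def)
  have perfect: "perfect_in cantor_E (range G)"
  proof (rule perfect_in_cantor_E_image[OF G_top \<open>inj G\<close>])
    fix j :: "nat \<Rightarrow> 'f" and \<beta>
    assume "j \<in> Espace - {0}"
    then obtain m where m: "\<And>w. w \<in> cylinder (z \<beta>, m) \<Longrightarrow> f w j = f (z \<beta>) j"
      using continuous_map_baire_cantor_ED[OF f] by blast
    have "G \<beta>' j = G \<beta> j" if "\<forall>i<m. \<beta>' i = \<beta> i" for \<beta>'
    proof -
      have "r \<beta>' m = r \<beta> m" using that by (simp add: r_def)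
      then have "z \<beta>' \<in> cylinder (z \<beta>, m)" using z_in[of \<beta>' m] by (intro near) simp
      then show ?thesis unfolding G_def by (rule m)
    qed
    then show "\<exists>n. \<forall>\<beta>'. (\<forall>i<n. \<beta>' i = \<beta> i) \<longrightarrow> G \<beta>' j = G \<beta> j" by blast
  qed
  have avoid_d: "range G \<inter> range d = {}"
  proof -
    have "G \<beta> \<noteq> d n" for \<beta> n
      using avoid[of "r \<beta> n" "\<beta> n"] z_in[of \<beta> "Suc n"] unfolding G_def r_Suc length_r
      by (metis imageI)
    then show ?thesis by fastforce
  qed
  have limit: "\<exists>k\<ge>n. \<exists>y'\<in>Y (\<sigma> k). \<forall>j\<in>F. y' j = y j"
    if y: "y \<in> range G" and F: "finite F" "F \<subseteq> Espace - {0}" for y F n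
  proof -
    obtain \<beta> where \<beta>: "y = f (z \<beta>)" using y by (auto simp: G_def)
    obtain m where m: "\<forall>k\<ge>m. \<forall>w\<in>cylinder (z \<beta>, k). \<forall>j\<in>F. f w j = f (z \<beta>) j"
      using continuous_map_baire_cantor_E_finite[OF f F] by blast
    \<comment> \<open>Late enough for the request \<open>n\<close>, and deep enough that
      \<open>f\<close> is constant on the coordinates in \<open>F\<close>.\<close>
    define k where "k = max n m"
    have "Y (\<sigma> k) \<inter> f ` cylinder (p (r \<beta> k)) \<noteq> {}"
      using unc[of "r \<beta> k"] unfolding length_r by (metis countable_empty)
    then obtain w where w: "w \<in> cylinder (p (r \<beta> k))" "f w \<in> Y (\<sigma> k)"
      by blast
    then have "\<forall>j\<in>F. f w j = y j"
      using m[rule_format, of k, OF _ near[OF w(1)]] by (simp add: \<beta> k_def)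
    then show ?thesis using w(2) by (intro exI[of _ k]) (auto simp: k_def)
  qed
  have "\<sigma> 0 = \<tau>" "\<forall>n. R (\<sigma> n) (\<sigma> (Suc n))"
    using \<Phi>(1)[of 0] \<Phi>(2) by (auto simp: I_def \<sigma>_def)
  moreover have "range G \<noteq> {}" "range G \<subseteq> range f" by (auto simp: G_def)
  moreover have "\<forall>y\<in>range G. \<forall>F n. finite F \<and> F \<subseteq> Espace - {0} \<longrightarrow>
      (\<exists>k\<ge>n. \<exists>y'\<in>Y (\<sigma> k). \<forall>j\<in>F. y' j = y j)"
    using limit by simp
  ultimately show ?thesis
    using perfect avoid_d by (intro exI[of _ "range G"] exI[of _ \<sigma>] conjI)
qed

section \<open>The dichotomy\<close>

text \<open>The states of the fusion are finite sequences of vectors. Closure of \<G> under finite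
  intersections lets all cylinders of a level accept the same new vector.\<close>

lemma ex_perfect_disjoint:
  fixes f :: "(nat \<Rightarrow> nat) \<Rightarrow> ((nat \<Rightarrow> 'f::{field,countable}) \<Rightarrow> bool)"
  assumes f: "continuous_map baire_space cantor_E f"
    and G: "\<And>W. W \<in> \<G> \<Longrightarrow> is_subspace W" "\<And>W. W \<in> \<G> \<Longrightarrow> infinite_dimensional W"
    and Inter: "\<And>\<F>. finite \<F> \<Longrightarrow> \<F> \<subseteq> \<G> \<Longrightarrow> Espace \<inter> \<Inter>\<F> \<in> \<G>"
    and unc: "uncountable {y \<in> range f. \<exists>W\<in>\<G>. \<forall>w\<in>W - {0}. \<not> y w}"
  shows "\<exists>P V. P \<noteq> {} \<and> P \<subseteq> range f \<and> perfect_in cantor_E P \<and>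
    is_subspace V \<and> infinite_dimensional V \<and> (\<forall>y\<in>P. \<forall>w\<in>V - {0}. \<not> y w)"
proof -
  define Y where "Y a = {y. \<exists>W\<in>\<G>. set a \<subseteq> W \<and> (\<forall>w\<in>W - {0}. \<not> y w)}" for a
  define R where "R a a' \<longleftrightarrow> (\<exists>v\<in>Espace. v \<notin> vs.span (set a) \<and> a' = a @ [v])"
    for a a' :: "(nat \<Rightarrow> 'f) list"
  have step: "\<exists>a'. R a a' \<and> (\<forall>N\<in>\<N>. uncountable (Y a' \<inter> f ` N))"
    if \<N>: "finite \<N>" "\<forall>N\<in>\<N>. uncountable (Y a \<inter> f ` N)" for a \<N>
  proof (rule ccontr)
    assume contra: "\<not> ?thesis"
    \<comment> \<open>The vectors that are bad for \<open>N\<close>. There are only countably many,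
      so some \<open>y\<close> in the trace of \<open>Y a\<close> avoids all the countable traces
      they produce.\<close>
    define B where "B N = {v \<in> Espace. countable (Y (a @ [v]) \<inter> f ` N)}" for N
    define Q where "Q N y W \<longleftrightarrow> y \<in> f ` N \<and> W \<in> \<G> \<and> set a \<subseteq> W \<and> (\<forall>w\<in>W - {0}. \<not> y w) \<and>
        (\<forall>v\<in>B N. y \<notin> Y (a @ [v]))" for N y W
    have "\<exists>y W. Q N y W" if "N \<in> \<N>" for N
    proof -
      have "countable (\<Union>v\<in>B N. Y (a @ [v]) \<inter> f ` N)"
        by (rule countable_UN) (auto simp: B_def intro: countable_subset[OF _ countable_Espace])
      then have "uncountable (Y a \<inter> f ` N - (\<Union>v\<in>B N. Y (a @ [v]) \<inter> f ` N))"
        using \<N>(2)[rule_format, OF that] uncountable_minus_countable by blast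
      then obtain y where y: "y \<in> Y a \<inter> f ` N" "y \<notin> (\<Union>v\<in>B N. Y (a @ [v]) \<inter> f ` N)"
        by (metis countable_empty ex_in_conv DiffD1 DiffD2)
      then obtain W where "W \<in> \<G>" "set a \<subseteq> W" "\<forall>w\<in>W - {0}. \<not> y w"
        unfolding Y_def by blast
      then show ?thesis using y unfolding Q_def by (intro exI[of _ y] exI[of _ W]) blast
    qed
    then obtain y W where yW: "\<And>N. N \<in> \<N> \<Longrightarrow> Q N (y N) (W N)" by metis
    \<comment> \<open>A new vector from this common intersection is bad for some \<open>N\<close> by
      assumption, yet \<open>W N\<close> still witnesses that \<open>y N\<close> satisfies the
      longer sequence.\<close>
    define V where "V = Espace \<inter> \<Inter>(W ` \<N>)"
    have "V \<in> \<G>" unfolding V_def using \<N>(1) yW by (intro Inter) (auto simp: Q_def)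
    then obtain v where v: "v \<in> V" "v \<notin> vs.span (set a)"
      using infinite_dimensionalD[OF G(2), of V "set a"] G(1) by (auto simp: is_subspace_def)
    have "v \<in> Espace" using v(1) by (simp add: V_def)
    then have "R a (a @ [v])" using v(2) by (auto simp: R_def)
    then obtain N where N: "N \<in> \<N>" "countable (Y (a @ [v]) \<inter> f ` N)" using contra by blast
    have Q: "Q N (y N) (W N)" using yW N(1) .
    have "set (a @ [v]) \<subseteq> W N" using Q N(1) v(1) by (auto simp: V_def Q_def)
    then have "y N \<in> Y (a @ [v])" using Q unfolding Y_def Q_def by blast
    moreover have "v \<in> B N" using N(2) \<open>v \<in> Espace\<close> by (simp add: B_def)
    ultimately show False using Q unfolding Q_def by blast
  qed
  have "Y [] \<inter> range f = {y \<in> range f. \<exists>W\<in>\<G>. \<forall>w\<in>W - {0}. \<not> y w}"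
    by (auto simp: Y_def)
  then have start: "uncountable (Y [] \<inter> range f)" using unc by simp
  \<comment> \<open>The fusion takes a sequence of points to avoid; a constant one serves, at the
    function that is \<open>undefined\<close> everywhere, which is extensional.\<close>
  have d: "range (\<lambda>_::nat. \<lambda>_. undefined) \<subseteq> topspace (cantor_E :: ((nat \<Rightarrow> 'f) \<Rightarrow> bool) topology)"
    by (auto simp: topspace_cantor_E extensional_def)
  have "\<forall>a \<N>. finite \<N> \<longrightarrow> (\<forall>N\<in>\<N>. uncountable (Y a \<inter> f ` N)) \<longrightarrow>
      (\<exists>a'. R a a' \<and> (\<forall>N\<in>\<N>. uncountable (Y a' \<inter> f ` N)))"
    by (intro allI impI step)
  from perfect_fusion[OF f start this d]
  obtain P a where a: "a 0 = []" "\<forall>n. R (a n) (a (Suc n))"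
    and P: "P \<noteq> {}" "P \<subseteq> range f" "perfect_in cantor_E P"
    and limit: "\<forall>y\<in>P. \<forall>F n. finite F \<and> F \<subseteq> Espace - {0} \<longrightarrow> (\<exists>k\<ge>n. \<exists>y'\<in>Y (a k). \<forall>j\<in>F. y' j = y j)"
    by (elim exE conjE) (rule that)
  have "\<exists>v. v \<in> Espace \<and> v \<notin> vs.span (set (a n)) \<and> a (Suc n) = a n @ [v]" for n
    using a(2)[rule_format, of n] unfolding R_def by blast
  then obtain v where v: "\<And>n. v n \<in> Espace" "\<And>n. v n \<notin> vs.span (set (a n))" "\<And>n. a (Suc n) = a n @ [v n]"
    by metis
  have set_a: "set (a n) = v ` {..<n}" for n
    by (induction n) (use a(1) v(3) in \<open>auto simp: lessThan_Suc\<close>)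
  let ?V = "vs.span (range v)"
  have "?V \<subseteq> Espace" using v(1) vs.span_minimal subspace_Espace by blast
  moreover have "infinite_dimensional ?V"
    using v(2) by (intro span_range_infinite_dimensional) (simp add: set_a)
  moreover have "\<not> y w" if yP: "y \<in> P" and w: "w \<in> ?V - {0}" for y w
  proof -
    \<comment> \<open>Choose a stage after which \<open>w\<close> is in the span built so far, then
      approximate \<open>y\<close> at the single coordinate \<open>w\<close>.\<close>
    obtain n where n: "\<And>m. m \<ge> n \<Longrightarrow> w \<in> vs.span (v ` {..<m})"
      using in_span_initial_segment w by blast
    obtain k y' where k: "k \<ge> n" "y' \<in> Y (a k)" "y' w = y w"
      using limit[rule_format, OF yP, of "{w}" n] w \<open>?V \<subseteq> Espace\<close> by auto
    then obtain W where W: "W \<in> \<G>" "set (a k) \<subseteq> W" "\<forall>w\<in>W - {0}. \<not> y' w"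
      by (auto simp: Y_def)
    have "vs.span (set (a k)) \<subseteq> W"
      using W(1,2) G(1) by (intro vs.span_minimal) (auto simp: is_subspace_def)
    then have "w \<in> W" using n[OF k(1)] by (auto simp: set_a)
    then show ?thesis using W(3) w k(3) by auto
  qed
  ultimately show ?thesis
    using P by (intro exI[of _ P] exI[of _ ?V]) (auto simp: is_subspace_def)
qed

text \<open>Injectivity of \<open>fst\<close> allows one subspace per set, so that countability of
  the sets passes to the whole system.\<close>

definition disjoint_system ::
    "((nat \<Rightarrow> 'f::field) \<Rightarrow> bool) set \<Rightarrow> (((nat \<Rightarrow> 'f) \<Rightarrow> bool) \<times> (nat \<Rightarrow> 'f) set) set \<Rightarrow> bool" where
  "disjoint_system Z S \<longleftrightarrow>
    (\<forall>(y, W)\<in>S. y \<in> Z \<and> is_subspace W \<and> (\<forall>w\<in>W - {0}. \<not> y w)) \<and> inj_on fst S \<and>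
    (\<forall>T\<subseteq>S. finite T \<longrightarrow> infinite_dimensional (Espace \<inter> \<Inter>(snd ` T)))"

text \<open>Every clause concerns finitely many pairs at a time, so it survives unions of chains and
  Zorn's lemma applies.\<close>

lemma ex_maximal_disjoint_system:
  fixes Z :: "((nat \<Rightarrow> 'f::field) \<Rightarrow> bool) set"
  shows "\<exists>S. disjoint_system Z S \<and> (\<forall>S'. disjoint_system Z S' \<and> S \<subseteq> S' \<longrightarrow> S' = S)"
proof -
  let ?sys = "disjoint_system Z"
  have "\<exists>S\<in>Collect ?sys. \<forall>S'\<in>Collect ?sys. S \<subseteq> S' \<longrightarrow> S' = S"
  proof (rule subset_Zorn_nonempty)
    have "?sys {}" by (simp add: disjoint_system_def infinite_dimensional_Espace)
    then show "Collect ?sys \<noteq> {}" by blast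
  next
    fix \<C> assume \<C>: "\<C> \<noteq> {}" "subset.chain (Collect ?sys) \<C>"
    then have sys: "?sys S" if "S \<in> \<C>" for S
      using that by (auto simp: subset_chain_def)
    have finite: "\<exists>S\<in>\<C>. T \<subseteq> S" if "finite T" "T \<subseteq> \<Union>\<C>" for T
      using finite_subset_Union_chain[OF that \<C>] by blast
    have "inj_on fst (\<Union>\<C>)"
    proof (rule inj_onI)
      fix p q assume pq: "p \<in> \<Union>\<C>" "q \<in> \<Union>\<C>" "fst p = fst q"
      then obtain S where "S \<in> \<C>" "{p, q} \<subseteq> S" using finite[of "{p, q}"] by auto
      then show "p = q" using sys[of S] pq(3) by (auto simp: disjoint_system_def inj_on_def)
    qed
    moreover have "infinite_dimensional (Espace \<inter> \<Inter>(snd ` T))" if "T \<subseteq> \<Union>\<C>" "finite T" for T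
      using finite[OF that(2,1)] sys that(2) unfolding disjoint_system_def by blast
    moreover have "\<forall>(y, W)\<in>\<Union>\<C>. y \<in> Z \<and> is_subspace W \<and> (\<forall>w\<in>W - {0}. \<not> y w)"
      using sys unfolding disjoint_system_def by blast
    ultimately show "\<Union>\<C> \<in> Collect ?sys" unfolding disjoint_system_def by blast
  qed
  then show ?thesis by blast
qed

section \<open>From characteristic functions back to sets\<close>

lemma charfun_disjoint_iff:
  assumes "A \<subseteq> Espace - {0}" "is_subspace V"
  shows "(\<forall>w\<in>V - {0}. \<not> charfun A w) \<longleftrightarrow> V \<inter> A = {}"
  using assms by (auto simp: charfun_def is_subspace_def)

lemma inj_on_charfun: "inj_on charfun {A. A \<subseteq> Espace - {0}}"
proof (rule inj_onI)
  fix A B :: "(nat \<Rightarrow> 'a) set"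
  assume AB: "A \<in> {A. A \<subseteq> Espace - {0}}" "B \<in> {A. A \<subseteq> Espace - {0}}" "charfun A = charfun B"
  have "w \<in> A \<longleftrightarrow> w \<in> B" if "w \<in> Espace - {0}" for w
    using fun_cong[OF AB(3), of w] that by (simp add: charfun_def)
  then show "A = B" using AB(1,2) by blast
qed

theorem theorem2p3:
  fixes \<A> :: "(nat \<Rightarrow> 'f::{field,countable}) set set"
  assumes "\<forall>A\<in>\<A>. A \<subseteq> Espace - {0}"
    and "uncountable \<A>"
    and "analytic_in cantor_E (charfun ` \<A>)"
  shows "\<exists>\<P> \<subseteq> \<A>. \<P> \<noteq> {} \<and> perfect_in cantor_E (charfun ` \<P>) \<and>
           (\<exists>V. is_subspace V \<and> infinite_dimensional V \<and>
              ((\<forall>A\<in>\<P>. V \<inter> A = {}) \<or> (\<forall>A\<in>\<P>. asymptotic_below A V)))"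
proof -
  have "\<A> \<noteq> {}" using assms(2) by auto
  then obtain f where f: "continuous_map baire_space cantor_E f" and range_f: "range f = charfun ` \<A>"
    using assms(3) by (auto simp: analytic_in_def baire_space_def)
  have "inj_on charfun \<A>" using assms(1) by (intro inj_on_subset[OF inj_on_charfun]) blast
  then have unc: "uncountable (range f)"
    unfolding range_f using assms(2) countable_image_inj_on by blast
  have f_top: "range f \<subseteq> topspace cantor_E"
    using f by (auto simp: continuous_map_def baire_space_def Pi_def)
  have lift: "\<exists>\<P>\<subseteq>\<A>. charfun ` \<P> = P \<and> \<P> \<noteq> {}" if "P \<noteq> {}" "P \<subseteq> range f" for P
    using that unfolding range_f by (metis image_is_empty subset_imageE)
  obtain S where sys: "disjoint_system (range f) S"
    and max: "\<And>S'. disjoint_system (range f) S' \<Longrightarrow> S \<subseteq> S' \<Longrightarrow> S' = S"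
    using ex_maximal_disjoint_system[of "range f"] by blast
  have S: "y \<in> range f \<and> is_subspace W \<and> (\<forall>w\<in>W - {0}. \<not> y w)" if "(y, W) \<in> S" for y W
    using sys that unfolding disjoint_system_def by blast
  have S_inj: "inj_on fst S" using sys by (simp add: disjoint_system_def)
  have S_inf: "infinite_dimensional (Espace \<inter> \<Inter>(snd ` T))" if "T \<subseteq> S" "finite T" for T
    using sys that by (simp add: disjoint_system_def)
  show ?thesis
  proof (cases "countable (fst ` S)")
    case False
    define \<G> where "\<G> = {Espace \<inter> \<Inter>(snd ` T) | T. T \<subseteq> S \<and> finite T}"
    have \<G>: "is_subspace W" "infinite_dimensional W" if "W \<in> \<G>" for W
    proof -
      obtain T where T: "W = Espace \<inter> \<Inter>(snd ` T)" "T \<subseteq> S" "finite T"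
        using \<open>W \<in> \<G>\<close> by (auto simp: \<G>_def)
      show "infinite_dimensional W" unfolding T(1) by (rule S_inf[OF T(2,3)])
      have "vs.subspace W"
        unfolding T(1) using S T(2) by (intro subspace_Espace_Int_Inter) fastforce
      then show "is_subspace W" by (simp add: is_subspace_def T(1))
    qed
    have Inter: "Espace \<inter> \<Inter>\<F> \<in> \<G>" if \<F>: "finite \<F>" "\<F> \<subseteq> \<G>" for \<F>
    proof -
      \<comment> \<open>Each member of \<F> comes from a finite subsystem; the union of these is a
        finite subsystem for the whole intersection.\<close>
      obtain T where T: "\<And>W. W \<in> \<F> \<Longrightarrow> W = Espace \<inter> \<Inter>(snd ` T W) \<and> T W \<subseteq> S \<and> finite (T W)"
        using \<F>(2) unfolding \<G>_def by (simp add: subset_eq) metis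
      have "Espace \<inter> \<Inter>\<F> = Espace \<inter> \<Inter>(snd ` (\<Union>W\<in>\<F>. T W))"
        using T by blast
      moreover have "(\<Union>W\<in>\<F>. T W) \<subseteq> S" "finite (\<Union>W\<in>\<F>. T W)" using T \<F>(1) by auto
      ultimately show ?thesis unfolding \<G>_def by (intro CollectI exI conjI)
    qed
    have "uncountable {y \<in> range f. \<exists>W\<in>\<G>. \<forall>w\<in>W - {0}. \<not> y w}"
    proof -
      have "y \<in> range f \<and> (\<exists>W\<in>\<G>. \<forall>w\<in>W - {0}. \<not> y w)" if "(y, W) \<in> S" for y W
      proof -
        have "Espace \<inter> \<Inter>(snd ` {(y, W)}) \<in> \<G>" using that unfolding \<G>_def by blast
        then have "Espace \<inter> W \<in> \<G>" by simp
        then show ?thesis using S[OF that] by blast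
      qed
      then have "fst ` S \<subseteq> {y \<in> range f. \<exists>W\<in>\<G>. \<forall>w\<in>W - {0}. \<not> y w}" by auto
      then show ?thesis using False countable_subset by blast
    qed
    then have "\<exists>P V. P \<noteq> {} \<and> P \<subseteq> range f \<and> perfect_in cantor_E P \<and>
        is_subspace V \<and> infinite_dimensional V \<and> (\<forall>y\<in>P. \<forall>w\<in>V - {0}. \<not> y w)"
      by (intro ex_perfect_disjoint[OF f \<G> Inter])
    then obtain P V where P: "P \<noteq> {}" "P \<subseteq> range f" "perfect_in cantor_E P"
      and V: "is_subspace V" "infinite_dimensional V" "\<forall>y\<in>P. \<forall>w\<in>V - {0}. \<not> y w"
      by (elim exE conjE) (rule that)
    obtain \<P> where \<P>: "\<P> \<subseteq> \<A>" "charfun ` \<P> = P" "\<P> \<noteq> {}" using lift[OF P(1,2)] by blast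
    have "V \<inter> A = {}" if "A \<in> \<P>" for A
    proof -
      have "\<forall>w\<in>V - {0}. \<not> charfun A w" using V(3) \<P>(2) that by blast
      then show ?thesis using charfun_disjoint_iff[of A V] assms(1) \<P>(1) V(1) that by blast
    qed
    then show ?thesis
      using \<P> P(3) V(1,2) by (intro exI[of _ \<P>] conjI exI[of _ V] disjI1 ballI) simp_all
  next
    case True
    then have "countable S" using S_inj countable_image_inj_on by blast
    have snd_S: "\<forall>W\<in>snd ` S. is_subspace W" using S by fastforce
    have "infinite_dimensional (Espace \<inter> \<Inter>\<F>)" if "finite \<F>" "\<F> \<subseteq> snd ` S" for \<F>
      using finite_subset_image[OF that] S_inf by metis
    then have "\<forall>\<F>\<subseteq>snd ` S. finite \<F> \<longrightarrow> infinite_dimensional (Espace \<inter> \<Inter>\<F>)" by simp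
    from ex_pseudo_intersection[OF countable_image[OF \<open>countable S\<close>] snd_S this]
    obtain V where V: "is_subspace V" "infinite_dimensional V"
      and below_V: "\<forall>W \<F>. is_subspace W \<and> infinite_dimensional W \<and> W \<subseteq> V \<and> finite \<F> \<and>
        \<F> \<subseteq> snd ` S \<longrightarrow> infinite_dimensional (W \<inter> (Espace \<inter> \<Inter>\<F>))"
      by (elim exE conjE) (rule that)
    \<comment> \<open>The extra point makes the set nonempty, so that a sequence enumerates it even
      when \<open>S\<close> is empty.\<close>
    have D: "countable (insert (\<lambda>_. undefined) (fst ` S))" using True by simp
    then obtain d :: "nat \<Rightarrow> (nat \<Rightarrow> 'f) \<Rightarrow> bool" where d: "range d = insert (\<lambda>_. undefined) (fst ` S)"
      using range_from_nat_into by (metis insert_not_empty)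
    have "fst ` S \<subseteq> range f" using S by fastforce
    moreover have "(\<lambda>_. undefined) \<in> topspace (cantor_E :: ((nat \<Rightarrow> 'f) \<Rightarrow> bool) topology)"
      by (simp add: topspace_cantor_E extensional_def)
    ultimately have d_top: "range d \<subseteq> topspace cantor_E"
      unfolding d using f_top by blast
    have start: "uncountable (UNIV \<inter> range f)" using unc by simp
    have step: "\<forall>(_::unit) \<N>. finite \<N> \<longrightarrow> (\<forall>N\<in>\<N>. uncountable (UNIV \<inter> f ` N)) \<longrightarrow>
        (\<exists>_::unit. True \<and> (\<forall>N\<in>\<N>. uncountable (UNIV \<inter> f ` N)))" by simp
    \<comment> \<open>With a single state and no constraint, the fusion becomes the perfect set
      theorem with the points of \<open>d\<close> avoided.\<close>
    from perfect_fusion[where Y = "\<lambda>_::unit. UNIV" and \<tau> = "()" and R = "\<lambda>_ _. True",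
        OF f start step d_top]
    obtain P where P: "P \<noteq> {}" "P \<subseteq> range f" "perfect_in cantor_E P" "P \<inter> range d = {}"
      by (elim exE conjE) (rule that)
    obtain \<P> where \<P>: "\<P> \<subseteq> \<A>" "charfun ` \<P> = P" "\<P> \<noteq> {}" using lift[OF P(1,2)] by blast
    have "asymptotic_below A V" if A: "A \<in> \<P>" for A
    proof (rule ccontr)
      assume "\<not> asymptotic_below A V"
      then obtain W where W: "is_subspace W" "W \<subseteq> V" "infinite_dimensional W" "W \<inter> A = {}"
        by (auto simp: asymptotic_below_def)
      \<comment> \<open>The pair is new because \<open>P\<close> avoids the first components of
        \<open>S\<close>; showing that \<open>S'\<close> is again a system contradicts
        maximality.\<close>
      define S' where "S' = insert (charfun A, W) S"
      have new: "charfun A \<notin> fst ` S" using A \<P>(2) P(4) d by blast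
      have "infinite_dimensional (Espace \<inter> \<Inter>(snd ` T))" if T: "T \<subseteq> S'" "finite T" for T
      proof (cases "(charfun A, W) \<in> T")
        case False
        then show ?thesis using T by (intro S_inf) (auto simp: S'_def)
      next
        case True
        define T0 where "T0 = T - {(charfun A, W)}"
        have "T = insert (charfun A, W) T0" using True by (auto simp: T0_def)
        \<comment> \<open>The subspaces of the old pairs meet \<open>W\<close> in infinite
          dimension, since \<open>W\<close> lies in the pseudo-intersection
          \<open>V\<close>.\<close>
        then have "Espace \<inter> \<Inter>(snd ` T) = W \<inter> (Espace \<inter> \<Inter>(snd ` T0))" by auto
        moreover have "T0 \<subseteq> S" "finite T0" using T by (auto simp: T0_def S'_def)
        then have "snd ` T0 \<subseteq> snd ` S" "finite (snd ` T0)" by auto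
        ultimately show ?thesis using below_V[rule_format, of W "snd ` T0"] W(1,2,3) by simp
      qed
      moreover have "inj_on fst S'" using S_inj new by (auto simp: S'_def)
      moreover have "\<forall>(y, W)\<in>S'. y \<in> range f \<and> is_subspace W \<and> (\<forall>w\<in>W - {0}. \<not> y w)"
      proof (intro ballI, clarify)
        fix y U assume "(y, U) \<in> S'"
        then consider "(y, U) \<in> S" | "y = charfun A" "U = W" unfolding S'_def by blast
        then show "y \<in> range f \<and> is_subspace U \<and> (\<forall>w\<in>U - {0}. \<not> y w)"
        proof cases
          case 2
          have "A \<in> \<A>" using A \<P>(1) by blast
          then have "charfun A \<in> range f" "A \<subseteq> Espace - {0}" using range_f assms(1) by auto
          then show ?thesis
            using W(1) charfun_disjoint_iff[THEN iffD2, OF _ W(1,4)] unfolding 2 by (intro conjI)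
        qed (rule S)
      qed
      ultimately have "disjoint_system (range f) S'"
        unfolding disjoint_system_def by (intro conjI allI impI)
      then have "S' = S" by (rule max) (auto simp: S'_def)
      then have "(charfun A, W) \<in> S" unfolding S'_def by blast
      then show False using new image_eqI[of "charfun A" fst "(charfun A, W)" S] by simp
    qed
    then show ?thesis
      using \<P> P(3) V by (intro exI[of _ \<P>] conjI exI[of _ V] disjI2 ballI) simp_all
  qed
qed

end
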